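(* Let $X=\mathbb{R}^d$. For each $b\in\mathbb{N}\setminus\{1\}$ let $\mathcal{R}_b:=\{A\in\mathcal{L}(X): \sigma(A)\text{ is exponentially } b\text{-resonant}\}$, and let $\mathcal{R}:=\bigcup_{b\in\mathbb{N}\setminus\{1\}}\mathcal{R}_b$. Then the set $\mathcal{R}$ is a meagre nullset in $\mathcal{L}(X)$.
   Context: Notation: $d$ is a positive integer, $\mathbb{N}$ is the set of positive integers, $\mathbb{R}^+=[0,\infty)$, $\log_b$ is the base-$b$ logarithm, and $\imath$ is the imaginary unit. $\mathcal{L}(X)$ is the space of all linear maps $A:X\to X$, identified (via a basis) with $\mathbb{R}^{d^2}$ and carrying the corresponding topology; "nullset" means Lebesgue nullset under this identification. $\sigma(A)\subset\mathbb{C}$ is the set of eigenvalues of $A$. A set is meagre if it is a countable union of nowhere dense sets. Nonresonance: for $z\in\mathbb{C}\setminus\{0\}$, $\arg z\in(-\pi,\pi]$ is defined by $z=|z|e^{\imath\arg z}$. For $\mathcal{Z}\subset\mathbb{C}$, $\mathrm{span}_{\mathbb{Q}}\mathcal{Z}$ is the smallest $\mathbb{Q}$-linear subspace of $\mathbb{C}$ containing $\mathcal{Z}$. Let $\mathbb{S}$ be the unit circle in $\mathbb{C}$. A non-empty set $\mathcal{Z}\subset r\mathbb{S}$, with $r>0$, is $b$-nonresonant if the set $\Delta_{\mathcal{Z}}:=\{1+\frac{\arg z-\arg w}{2\pi}: z,w\in\mathcal{Z}\}$ satisfies $\Delta_{\mathcal{Z}}\cap\mathbb{Q}=\{1\}$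 and $\log_b r\notin\mathrm{span}_{\mathbb{Q}}\Delta_{\mathcal{Z}}$. An arbitrary set $\mathcal{Z}\subset\mathbb{C}$ is $b$-nonresonant if for every $r>0$ the set $\mathcal{Z}\cap r\mathbb{S}$ is either $b$-nonresonant or empty; otherwise it is $b$-resonant. A set $\mathcal{Z}\subset\mathbb{C}$ is exponentially $b$-nonresonant if $e^{t\mathcal{Z}}:=\{e^{tz}:z\in\mathcal{Z}\}$ is $b$-nonresonant for some $t\in\mathbb{R}^+$; otherwise it is exponentially $b$-resonant. *)

theory Defs
  imports "HOL-Analysis.Analysis"
begin

definition nowhere_dense :: "'a::topological_space set \<Rightarrow> bool" where
  "nowhere_dense S \<longleftrightarrow> interior (closure S) = {}"

definition meagre :: "'a::topological_space set \<Rightarrow> bool" where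
  "meagre S \<longleftrightarrow> (\<exists>F :: nat \<Rightarrow> 'a set. (\<forall>n. nowhere_dense (F n)) \<and> S = (\<Union>n. F n))"

definition span_rat :: "complex set \<Rightarrow> complex set" where
  "span_rat Z = module.span (\<lambda>(q::rat) (z::complex). of_rat q * z) Z"

(* The library's Arg takes its values in (-pi, pi]; its value at 0 is immaterial, since
   Delta is only applied to sets of nonzero numbers. *)
definition Delta :: "complex set \<Rightarrow> complex set" where
  "Delta Z = {1 + complex_of_real ((Arg z - Arg w) / (2 * pi)) | z w. z \<in> Z \<and> w \<in> Z}"

(* Nonresonance of a non-empty subset Z of the circle of radius r > 0. *)
definition circle_nonresonant :: "nat \<Rightarrow> real \<Rightarrow> complex set \<Rightarrow> bool" where
  "circle_nonresonant b r Z \<longleftrightarrow>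
     Delta Z \<inter> \<rat> = {1} \<and> complex_of_real (log (real b) r) \<notin> span_rat (Delta Z)"

definition nonresonant :: "nat \<Rightarrow> complex set \<Rightarrow> bool" where
  "nonresonant b Z \<longleftrightarrow>
     (\<forall>r>0. Z \<inter> sphere 0 r = {} \<or> circle_nonresonant b r (Z \<inter> sphere 0 r))"

definition exp_nonresonant :: "nat \<Rightarrow> complex set \<Rightarrow> bool" where
  "exp_nonresonant b Z \<longleftrightarrow>
     (\<exists>t::real. t \<ge> 0 \<and> nonresonant b ((\<lambda>z. exp (complex_of_real t * z)) ` Z))"

abbreviation exp_resonant :: "nat \<Rightarrow> complex set \<Rightarrow> bool" where
  "exp_resonant b Z \<equiv> \<not> exp_nonresonant b Z"

(* The complex eigenvalues of a real linear map, i.e. those of its complexification. *)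
definition spectrum :: "(real^'n \<Rightarrow> real^'n) \<Rightarrow> complex set" where
  "spectrum A =
     {z. \<exists>v::complex^'n. v \<noteq> 0 \<and> map_matrix complex_of_real (matrix A) *v v = z *s v}"

(* The space of all linear maps on X = real^'n is identified with real^'n^'n by taking matrices
   with respect to the standard basis; topological and measure-theoretic notions for a set R of
   linear maps refer to the image matrix ` R. *)
definition resonant_maps :: "nat \<Rightarrow> (real^'n \<Rightarrow> real^'n) set" where
  "resonant_maps b = {A. linear A \<and> exp_resonant b (spectrum A)}"

end

theory Submission
  imports Defs
begin

text \<open>
  Why almost every matrix has an exponentially nonresonant spectrum. Let \<open>Z\<close> be the spectrum of a real
  matrix. If different eigenvalues have different real parts, except for conjugate pairs, then each
  circle meets \<open>e\<^sup>t\<^sup>Z\<close> with \<open>t > 0\<close> in the points coming from one pair \<open>z\<close>, \<open>cnj z\<close>, and nonresonance on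
  the circle only asks that \<open>t Im z / \<pi>\<close> be irrational (for non-real \<open>z\<close>) and that \<open>t Re z / ln b\<close> not
  be a rational combination of \<open>1\<close> and \<open>t Im z / \<pi>\<close>. Unless \<open>Re z = q (ln b / \<pi>) Im z\<close> for a rational
  \<open>q\<close>, this fails for countably many \<open>t\<close> only, so a good \<open>t\<close> exists (\<open>exp_nonresonant_if_generic\<close>).

  So a resonant matrix has an eigenvalue on one of the countably many lines \<open>Re z = q (ln b / \<pi>) Im z\<close>,
  or two eigenvalues \<open>z\<close>, \<open>w\<close> with the same real part and \<open>z \<notin> {w, cnj w}\<close>. It remains to
  cover these matrices by countably many closed negligible sets; such sets are nowhere dense, so the
  cover yields a meagre nullset. That a closed set is negligible is checked on parallel lines of
  matrices, by Fubini (\<open>negligible_if_line_sections_countable\<close>).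

  For an eigenvalue on a fixed line, the direction of the identity matrix works, since it shifts the
  whole spectrum horizontally (\<open>negligible_eigenvalue_on_line\<close>).

  For a shared real part, consider the Lyapunov operator \<open>S \<mapsto> A\<^sup>T S + S A\<close> on symmetric matrices. The
  Hermitian forms \<open>v\<^sup>* S v\<close> at an eigenvector \<open>v\<close> for \<open>z\<close> are eigenfunctionals for \<open>2 Re z\<close>. A shared
  real part thus gives two independent eigenfunctionals for the same eigenvalue; some combination of
  them vanishes at a prescribed starting matrix and therefore on its whole orbit. Hence the orbit does
  not span the symmetric matrices, and a determinant that is polynomial in \<open>A\<close> vanishes
  (\<open>det_krylov_eq_0\<close>). For a suitable diagonal matrix this determinant is of Vandermonde type and
  nonzero (\<open>det_krylov_diag_nonzero\<close>), and by homogeneity it is not identically zero on any line in the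
  direction of that diagonal matrix (\<open>shared_real_part_cover\<close>).
\<close>

section \<open>Negligible closed sets and meagre covers\<close>

text \<open>
  Fubini without a choice of coordinates: integrate the indicator of \<open>C\<close> at \<open>A + s B\<close> over all
  points \<open>A\<close> and all real \<open>s\<close>. Integrating over \<open>s\<close> first gives zero. Integrating over \<open>A\<close> first
  gives, by translation invariance, the measure of \<open>C\<close> for every \<open>s\<close>, hence infinitely many copies
  of it.
\<close>

lemma negligible_if_line_sections_countable:
  fixes C :: "'a::euclidean_space set"
  assumes "closed C" and sec: "\<And>A. countable {s. A + s *\<^sub>R B \<in> C}"
  shows "negligible C"
proof -
  have C: "C \<in> sets lborel"
    using \<open>closed C\<close> by simp
  let ?h = "\<lambda>A s. indicator C (A + s *\<^sub>R B) :: ennreal"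
  have cont: "continuous_on UNIV (\<lambda>x::'a \<times> real. fst x + snd x *\<^sub>R B)"
    by (intro continuous_intros)
  have meas0: "(\<lambda>x::'a \<times> real. fst x + snd x *\<^sub>R B) \<in> borel_measurable (lborel \<Otimes>\<^sub>M lborel)"
    using borel_measurable_continuous_onI[OF cont]
    by (simp add: borel_prod cong: measurable_cong_sets)
  have ind: "(indicator C :: 'a \<Rightarrow> ennreal) \<in> borel_measurable borel"
    using C by simp
  have meas: "case_prod ?h \<in> borel_measurable (lborel \<Otimes>\<^sub>M lborel)"
    using measurable_compose[OF meas0 ind] by (simp add: case_prod_unfold)
  have shift: "(\<integral>\<^sup>+ A. ?h A s \<partial>lborel) = emeasure lborel C" for s
  proof -
    have "(\<integral>\<^sup>+ A. ?h A s \<partial>lborel) = (\<integral>\<^sup>+ A. indicator C A \<partial>distr lborel borel ((+) (s *\<^sub>R B)))"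
      by (subst nn_integral_distr) (use C in \<open>auto simp: add.commute\<close>)
    also have "\<dots> = emeasure lborel C"
      using C by (simp add: lborel_distr_plus)
    finally show ?thesis .
  qed
  have inner: "(\<integral>\<^sup>+ s. ?h A s \<partial>lborel) = 0" for A
  proof -
    have "(\<integral>\<^sup>+ s. ?h A s \<partial>lborel) = (\<integral>\<^sup>+ s. indicator {s. A + s *\<^sub>R B \<in> C} s \<partial>lborel)"
      by (intro nn_integral_cong) (auto simp: indicator_def)
    also have "\<dots> = emeasure lborel {s. A + s *\<^sub>R B \<in> C}"
      by (intro nn_integral_indicator) (use sec[of A] in \<open>auto intro: sets.countable\<close>)
    finally show ?thesis
      using emeasure_lborel_countable[OF sec[of A]] by simp
  qed
  have "(\<integral>\<^sup>+ s. \<integral>\<^sup>+ A. ?h A s \<partial>lborel \<partial>lborel) = (\<integral>\<^sup>+ A. \<integral>\<^sup>+ s. ?h A s \<partial>lborel \<partial>lborel)"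
    by (rule lborel_pair.Fubini'[OF meas])
  also have "\<dots> = 0"
    by (simp add: inner)
  finally have "emeasure lborel C * \<infinity> = 0"
    by (simp add: shift)
  then have "C \<in> null_sets lborel"
    using C by (auto simp: null_sets_def)
  then have "C \<in> null_sets lebesgue"
    by (rule null_sets_completionI)
  then show ?thesis
    by (simp add: negligible_iff_null_sets)
qed

text \<open>
  A closed negligible set is nowhere dense, since a non-empty open set is not negligible. So one
  cover by closed negligible sets settles both smallness notions at once.
\<close>

lemma meagre_null_if_countable_closed_negligible_cover:
  fixes S :: "'a::euclidean_space set"
  assumes "countable \<C>" and closed: "\<And>C. C \<in> \<C> \<Longrightarrow> closed C"
    and neg: "\<And>C. C \<in> \<C> \<Longrightarrow> negligible C" and cover: "S \<subseteq> \<Union>\<C>"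
  shows "meagre S \<and> S \<in> null_sets lebesgue"
proof
  have "negligible S"
    using negligible_countable_Union[of \<C>] assms negligible_subset by blast
  then show "S \<in> null_sets lebesgue"
    by (simp add: negligible_iff_null_sets)
  \<comment> \<open>The empty set is inserted so that the enumeration makes sense for an empty family.\<close>
  define F where "F n = from_nat_into (insert {} \<C>) n \<inter> S" for n
  have "nowhere_dense (F n)" for n
  proof -
    define C where "C = from_nat_into (insert {} \<C>) n"
    have "C \<in> insert {} \<C>"
      unfolding C_def by (rule from_nat_into) simp
    then have C: "closed C" "negligible C"
      using closed neg by auto
    have "closure (F n) \<subseteq> C"
      unfolding F_def C_def[symmetric] using C(1) by (meson Int_lower1 closure_minimal)
    then have "negligible (interior (closure (F n)))"
      using C(2) interior_subset negligible_subset by (metis subset_trans)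
    then show ?thesis
      unfolding nowhere_dense_def using open_interior open_not_negligible by blast
  qed
  moreover have "S = (\<Union>n. F n)"
  proof -
    have "range (from_nat_into (insert {} \<C>)) = insert {} \<C>"
      using \<open>countable \<C>\<close> by (intro range_from_nat_into) auto
    moreover have "(\<Union>n. F n) = \<Union>(range (from_nat_into (insert {} \<C>))) \<inter> S"
      by (auto simp: F_def)
    ultimately show ?thesis
      using cover by auto
  qed
  ultimately show "meagre S"
    unfolding meagre_def by blast
qed

section \<open>Determinants along a line of matrices\<close>

text \<open>
  Far out on a line of direction \<open>B\<close> one looks, up to scaling, at \<open>B\<close> itself: \<open>A + s B\<close> is a multiple
  of \<open>B + A / s\<close>, where \<open>f\<close> does not vanish for large \<open>s\<close> by continuity. When \<open>f\<close> is polynomial on the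
  line it therefore has finitely many zeros there.
\<close>

lemma homogeneous_nonzero_meets_line:
  fixes f :: "'a::real_normed_vector \<Rightarrow> 'b::{zero,t2_space}"
  assumes cont: "continuous_on UNIV f"
    and homog: "\<And>c x. c \<noteq> 0 \<Longrightarrow> f x \<noteq> 0 \<Longrightarrow> f (c *\<^sub>R x) \<noteq> 0"
    and "f B \<noteq> 0"
  shows "\<exists>s. f (A + s *\<^sub>R B) \<noteq> 0"
proof -
  have "open {x. f x \<noteq> 0}"
    by (rule open_Collect_neq[OF cont continuous_on_const])
  moreover have "((\<lambda>\<epsilon>. B + \<epsilon> *\<^sub>R A) \<longlongrightarrow> B + 0 *\<^sub>R A) (at_right 0)"
    by (intro tendsto_intros)
  ultimately have "eventually (\<lambda>\<epsilon>. B + \<epsilon> *\<^sub>R A \<in> {x. f x \<noteq> 0}) (at_right 0)"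
    using \<open>f B \<noteq> 0\<close> by (intro topological_tendstoD) auto
  then obtain \<epsilon> where "\<epsilon> > 0" "f (B + \<epsilon> *\<^sub>R A) \<noteq> 0"
    using eventually_happens'[OF trivial_limit_at_right_real[of 0]
        eventually_conj[OF eventually_at_right_less[of "0::real"]]] by auto
  then have "f ((1 / \<epsilon>) *\<^sub>R (B + \<epsilon> *\<^sub>R A)) \<noteq> 0"
    by (intro homog) auto
  then show ?thesis
    using \<open>\<epsilon> > 0\<close> by (intro exI[of _ "1 / \<epsilon>"]) (simp add: scaleR_add_right add.commute)
qed

text \<open>
  Taking determinants over the polynomial ring exhibits the determinant of a matrix with polynomial
  entries as a polynomial function.
\<close>

lemma poly_det: "poly (det P) x = det (map_matrix (\<lambda>p. poly p x) P)"
  by (simp add: det_def poly_sum poly_prod)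

lemma continuous_on_det:
  fixes F :: "'a::topological_space \<Rightarrow> 'b::real_normed_field^'n^'n"
  assumes "\<And>i j. continuous_on S (\<lambda>x. F x $ i $ j)"
  shows "continuous_on S (\<lambda>x. det (F x))"
  unfolding det_def by (intro continuous_intros assms)

lemma det_eq_0_iff_ker:
  fixes A :: "'a::field^'n^'n"
  shows "det A = 0 \<longleftrightarrow> (\<exists>x. x \<noteq> 0 \<and> A *v x = 0)"
  using invertible_det_nz[of A] matrix_left_invertible_ker[of A] invertible_left_inverse[of A]
  by metis

section \<open>A polynomial that vanishes when two eigenvalues share their real part\<close>

text \<open>
  The Lyapunov operator. Its eigenvalues are the sums of two eigenvalues of \<open>A\<close>, so on symmetric
  matrices, where each unordered pair counts once, a coincidence \<open>z + cnj z = w + cnj w\<close> makes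
  \<open>2 Re z\<close> a multiple eigenvalue.
\<close>

definition lyap :: "'a::comm_ring_1^'n^'n \<Rightarrow> 'a^'n^'n \<Rightarrow> 'a^'n^'n" where
  "lyap A S = transpose A ** S + S ** A"

definition lyap_pow :: "'a::comm_ring_1^'n^'n \<Rightarrow> nat \<Rightarrow> 'a^'n^'n" where
  "lyap_pow A k = (lyap A ^^ k) (\<chi> i j. 1)"

lemma lyap_pow_0 [simp]: "lyap_pow A 0 $ i $ j = 1"
  by (simp add: lyap_pow_def)

lemma lyap_pow_Suc: "lyap_pow A (Suc k) = lyap A (lyap_pow A k)"
  by (simp add: lyap_pow_def)

lemma lyap_nth: "lyap A S $ i $ j = (\<Sum>k\<in>UNIV. A$k$i * S$k$j) + (\<Sum>k\<in>UNIV. S$i$k * A$k$j)"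
  by (simp add: lyap_def matrix_matrix_mult_def transpose_def)

lemma lyap_pow_poly:
  "map_matrix (\<lambda>p. poly p x) (lyap_pow P k) = lyap_pow (map_matrix (\<lambda>p. poly p x) P) k"
proof (induction k)
  case (Suc k)
  have *: "poly (lyap_pow P k $ i $ j) x = lyap_pow (map_matrix (\<lambda>p. poly p x) P) k $ i $ j" for i j
    using Suc by (metis nth_map_matrix)
  show ?case
    by (simp add: vec_eq_iff lyap_pow_Suc lyap_nth poly_sum *)
qed (simp add: vec_eq_iff)

lemma lyap_pow_scale:
  "lyap_pow (\<chi> i j. c * A $ i $ j) k $ i $ j = c ^ k * lyap_pow A k $ i $ j"
proof (induction k arbitrary: i j)
  case (Suc k)
  show ?case
    unfolding lyap_pow_Suc lyap_nth distrib_left sum_distrib_left Suc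
    by (intro arg_cong2[where f = "(+)"] sum.cong) (simp_all add: mult_ac)
qed simp

lemma continuous_on_lyap_pow:
  fixes F :: "'a::topological_space \<Rightarrow> 'b::real_normed_field^'n^'n"
  assumes "\<And>i j. continuous_on S (\<lambda>x. F x $ i $ j)"
  shows "continuous_on S (\<lambda>x. lyap_pow (F x) k $ i $ j)"
proof (induction k arbitrary: i j)
  case (Suc k)
  then show ?case
    unfolding lyap_pow_Suc lyap_nth
    by (intro continuous_on_add continuous_on_sum continuous_on_mult assms)
qed simp

lemma lyap_pow_diag:
  "lyap_pow (\<chi> i j. if i = j then b i else 0) k $ i $ j = (b i + b j) ^ k"
proof (induction k arbitrary: i j)
  case (Suc k)
  have "lyap_pow (\<chi> i j. if i = j then b i else 0) (Suc k) $ i $ j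
    = (\<Sum>l\<in>UNIV. (if l = i then b i * (b i + b j) ^ k else 0))
      + (\<Sum>l\<in>UNIV. (if l = j then b j * (b i + b j) ^ k else 0))"
    unfolding lyap_pow_Suc lyap_nth Suc
    by (intro arg_cong2[where f = "(+)"] sum.cong) auto
  also have "\<dots> = (b i + b j) ^ Suc k"
    by (simp add: algebra_simps)
  finally show ?case .
qed simp

text \<open>
  The rows indexed by pairs \<open>(i, j)\<close> in order list the Krylov vectors of the Lyapunov operator that
  start at the all-ones matrix; \<open>e\<close> numbers these rows by the powers. The Krylov vectors are symmetric
  and so span at most the symmetric matrices; the remaining rows \<open>E\<^sub>i\<^sub>j - E\<^sub>j\<^sub>i\<close> span a complement, which
  turns the question whether the Krylov vectors are independent into one about a square determinant.
  The index \<open>'n \<times> 'n\<close> makes this possible without a type of unordered pairs.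
\<close>

definition krylov_matrix :: "('n \<Rightarrow> nat) \<Rightarrow> ('n \<times> 'n \<Rightarrow> nat) \<Rightarrow> 'a::comm_ring_1^'n^'n
    \<Rightarrow> 'a^('n \<times> 'n)^('n \<times> 'n)" where
  "krylov_matrix num e A = (\<chi> p q.
     if num (fst p) \<le> num (snd p) then lyap_pow A (e p) $ fst q $ snd q
     else of_bool (q = p) - of_bool (q = prod.swap p))"

lemma krylov_poly:
  "map_matrix (\<lambda>p. poly p x) (krylov_matrix num e P) = krylov_matrix num e (map_matrix (\<lambda>p. poly p x) P)"
proof -
  have "poly (lyap_pow P k $ i $ j) x = lyap_pow (map_matrix (\<lambda>p. poly p x) P) k $ i $ j" for i j k
    using lyap_pow_poly[of x P k] by (metis nth_map_matrix)
  note poly_pow = this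
  have "map_matrix (\<lambda>p. poly p x) (krylov_matrix num e P) $ p $ q
      = krylov_matrix num e (map_matrix (\<lambda>p. poly p x) P) $ p $ q" for p q
    unfolding nth_map_matrix krylov_matrix_def vec_lambda_beta poly_pow[symmetric] by simp
  then show ?thesis
    unfolding vec_eq_iff by blast
qed

lemma continuous_on_det_krylov:
  fixes F :: "'a::topological_space \<Rightarrow> 'b::real_normed_field^'n^'n"
  assumes "\<And>i j. continuous_on S (\<lambda>x. F x $ i $ j)"
  shows "continuous_on S (\<lambda>x. det (krylov_matrix num e (F x)))"
proof (rule continuous_on_det)
  show "continuous_on S (\<lambda>x. krylov_matrix num e (F x) $ p $ q)" for p q
    by (cases "num (fst p) \<le> num (snd p)")
       (simp_all add: krylov_matrix_def continuous_on_lyap_pow assms)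
qed

text \<open>
  Scaling \<open>A\<close> scales the rows by powers of the factor, so the determinant is homogeneous.
\<close>

lemma det_krylov_scale:
  fixes A :: "real^'n^'n"
  assumes "c \<noteq> 0" "det (krylov_matrix num e A) \<noteq> 0"
  shows "det (krylov_matrix num e (c *\<^sub>R A)) \<noteq> 0"
proof -
  define w where "w p = (if num (fst p) \<le> num (snd p) then c ^ e p else 1)" for p
  have cA: "c *\<^sub>R A = (\<chi> i j. c * A $ i $ j)"
    by (simp add: vec_eq_iff)
  have "krylov_matrix num e (c *\<^sub>R A) = (\<chi> p. w p *s (krylov_matrix num e A $ p))"
    by (simp add: vec_eq_iff krylov_matrix_def w_def cA lyap_pow_scale)
  then have "det (krylov_matrix num e (c *\<^sub>R A)) = prod w UNIV * det (krylov_matrix num e A)"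
    by (simp add: det_rows_mul)
  then show ?thesis
    using assms by (simp add: w_def)
qed

lemma inner_transpose_mult: "x \<bullet> (transpose A *v y) = (A *v x) \<bullet> (y :: real^'n)"
  by (metis dot_lmul_matrix inner_commute transpose_matrix_vector)

text \<open>
  With \<open>v = p + \<i> q\<close> an eigenvector of \<open>M\<close> for \<open>a + \<i> \<beta>\<close>, the left-hand side is the real part of
  \<open>v\<^sup>* (lyap M S) v\<close>. Moving \<open>M\<close> onto the two copies of \<open>v\<close> gives the eigenvalue plus its conjugate,
  \<open>2 a\<close>, as a factor: the form at \<open>v\<close> is an eigenfunctional of the Lyapunov operator.
\<close>

lemma lyap_quadratic:
  fixes M S :: "real^'n^'n"
  assumes "M *v p = a *\<^sub>R p - \<beta> *\<^sub>R q" "M *v q = \<beta> *\<^sub>R p + a *\<^sub>R q"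
  shows "p \<bullet> (lyap M S *v p) + q \<bullet> (lyap M S *v q)
    = 2 * a * (p \<bullet> (S *v p) + q \<bullet> (S *v q))"
proof -
  have "x \<bullet> (lyap M S *v x) = (M *v x) \<bullet> (S *v x) + x \<bullet> (S *v (M *v x))" for x
  proof -
    have "lyap M S *v x = transpose M *v (S *v x) + S *v (M *v x)"
      by (simp add: lyap_def matrix_vector_mult_add_rdistrib matrix_vector_mul_assoc)
    then show ?thesis
      by (simp only: inner_add_right inner_transpose_mult)
  qed
  then show ?thesis
    by (simp add: assms matrix_vector_right_distrib matrix_vector_mult_diff_distrib
        matrix_vector_mult_scaleR inner_add_left inner_add_right inner_diff_left inner_diff_right
        algebra_simps)
qed

lemma lyap_pow_quadratic:
  fixes M :: "real^'n^'n"
  assumes "M *v p = a *\<^sub>R p - \<beta> *\<^sub>R q" "M *v q = \<beta> *\<^sub>R p + a *\<^sub>R q"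
  shows "p \<bullet> (lyap_pow M k *v p) + q \<bullet> (lyap_pow M k *v q)
    = (2 * a) ^ k * (p \<bullet> (lyap_pow M 0 *v p) + q \<bullet> (lyap_pow M 0 *v q))"
proof (induction k)
  case (Suc k)
  then show ?case
    unfolding lyap_pow_Suc lyap_quadratic[OF assms] by (simp only: power_Suc mult.assoc)
qed simp

text \<open>
  Two eigenfunctionals \<open>\<ell>\<close>, \<open>\<ell>'\<close> of the Lyapunov operator with the common eigenvalue \<open>2 a\<close> have a
  nontrivial combination that vanishes at the starting matrix, hence on the whole Krylov sequence.
  Being a symmetric form, it also kills the antisymmetric rows. Its coefficients \<open>c\<close> are therefore in
  the kernel of the Krylov matrix, and they are nonzero because \<open>\<beta>\<^sup>2 \<noteq> \<gamma>\<^sup>2\<close> makes the two functionals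
  linearly independent.
\<close>

lemma det_krylov_eq_0:
  fixes M :: "real^'n^'n"
  assumes pq: "M *v p = a *\<^sub>R p - \<beta> *\<^sub>R q" "M *v q = \<beta> *\<^sub>R p + a *\<^sub>R q" "p \<noteq> 0 \<or> q \<noteq> 0"
    and pq': "M *v p' = a *\<^sub>R p' - \<gamma> *\<^sub>R q'" "M *v q' = \<gamma> *\<^sub>R p' + a *\<^sub>R q'" "p' \<noteq> 0 \<or> q' \<noteq> 0"
    and neq: "\<beta>\<^sup>2 \<noteq> \<gamma>\<^sup>2"
  shows "det (krylov_matrix num e M) = 0"
proof -
  define h where "h = p \<bullet> (lyap_pow M 0 *v p) + q \<bullet> (lyap_pow M 0 *v q)"
  define h' where "h' = p' \<bullet> (lyap_pow M 0 *v p') + q' \<bullet> (lyap_pow M 0 *v q')"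
  obtain \<alpha> \<alpha>' where \<alpha>: "\<alpha> \<noteq> 0 \<or> \<alpha>' \<noteq> 0" "\<alpha> * h + \<alpha>' * h' = 0"
  proof (cases "h = 0 \<and> h' = 0")
    case True
    with that[of 1 1] show ?thesis by simp
  next
    case False
    with that[of h' "- h"] show ?thesis by auto
  qed
  define G where "G k l = \<alpha> * (p$k * p$l + q$k * q$l) + \<alpha>' * (p'$k * p'$l + q'$k * q'$l)" for k l
  define c :: "real^('n \<times> 'n)" where "c = (\<chi> x. G (fst x) (snd x))"
  have pair: "(\<Sum>x\<in>UNIV. S $ fst x $ snd x * c $ x)
      = \<alpha> * (p \<bullet> (S *v p) + q \<bullet> (S *v q)) + \<alpha>' * (p' \<bullet> (S *v p') + q' \<bullet> (S *v q'))"
    for S :: "real^'n^'n"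
  proof -
    have "(\<Sum>x\<in>UNIV. S $ fst x $ snd x * c $ x) = (\<Sum>k\<in>UNIV. \<Sum>l\<in>UNIV. S $ k $ l * G k l)"
      by (simp add: c_def sum.cartesian_product case_prod_unfold)
    also have "\<dots> = \<alpha> * (p \<bullet> (S *v p) + q \<bullet> (S *v q)) + \<alpha>' * (p' \<bullet> (S *v p') + q' \<bullet> (S *v q'))"
      by (simp add: G_def inner_vec_def matrix_vector_mult_def sum_distrib_left sum.distrib
          algebra_simps)
    finally show ?thesis .
  qed
  have "krylov_matrix num e M *v c = 0"
  proof -
    have "(krylov_matrix num e M *v c) $ x = 0" for x
    proof (cases "num (fst x) \<le> num (snd x)")
      case True
      then have "(krylov_matrix num e M *v c) $ x
          = (\<Sum>y\<in>UNIV. lyap_pow M (e x) $ fst y $ snd y * c $ y)"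
        by (simp add: matrix_vector_mult_def krylov_matrix_def)
      also have "\<dots> = \<alpha> * ((2 * a) ^ e x * h) + \<alpha>' * ((2 * a) ^ e x * h')"
        unfolding pair lyap_pow_quadratic[OF pq(1,2), of "e x"]
          lyap_pow_quadratic[OF pq'(1,2), of "e x"] h_def h'_def ..
      also have "\<dots> = (2 * a) ^ e x * (\<alpha> * h + \<alpha>' * h')"
        by (simp add: algebra_simps)
      finally show ?thesis
        by (simp add: \<alpha>)
    next
      case False
      then have "(krylov_matrix num e M *v c) $ x
          = (\<Sum>y\<in>UNIV. (of_bool (y = x) - of_bool (y = prod.swap x)) * c $ y)"
        by (simp add: matrix_vector_mult_def krylov_matrix_def)
      also have "\<dots> = c $ x - c $ prod.swap x"
        by (simp add: left_diff_distrib sum_subtractf of_bool_def if_distribR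
            if_distrib[of "\<lambda>x. x * _"] cong: if_cong)
      also have "\<dots> = 0"
        by (simp add: c_def G_def algebra_simps)
      finally show ?thesis .
    qed
    then show ?thesis
      by (simp add: vec_eq_iff)
  qed
  moreover have "c \<noteq> 0"
  proof
    assume "c = 0"
    then have G0: "G k l = 0" for k l
      by (auto simp: c_def vec_eq_iff)
    \<comment> \<open>The square of the operator N separates the two real invariant subspaces, as it acts on them
      by the distinct scalars \<open>- \<beta>\<^sup>2\<close> and \<open>- \<gamma>\<^sup>2\<close>.\<close>
    define N where "N x = M *v x - a *\<^sub>R x" for x
    have linN: "linear N"
      unfolding N_def by (intro linear_compose_sub matrix_vector_mul_linear linear_scale_self)
    have N1: "N p = - \<beta> *\<^sub>R q" "N q = \<beta> *\<^sub>R p" "N p' = - \<gamma> *\<^sub>R q'" "N q' = \<gamma> *\<^sub>R p'"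
      by (simp_all add: N_def pq pq')
    have N2: "N (N p) = - \<beta>\<^sup>2 *\<^sub>R p" "N (N q) = - \<beta>\<^sup>2 *\<^sub>R q"
       "N (N p') = - \<gamma>\<^sup>2 *\<^sub>R p'" "N (N q') = - \<gamma>\<^sup>2 *\<^sub>R q'"
      by (simp_all only: N1 linear_cmul[OF linN] scaleR_scaleR power2_eq_square) simp_all
    have comb: "\<alpha> *\<^sub>R ((p \<bullet> x) *\<^sub>R p + (q \<bullet> x) *\<^sub>R q) + \<alpha>' *\<^sub>R ((p' \<bullet> x) *\<^sub>R p' + (q' \<bullet> x) *\<^sub>R q') = 0"
      (is "\<alpha> *\<^sub>R ?u + \<alpha>' *\<^sub>R ?v = 0") for x
    proof -
      have "(\<Sum>l\<in>UNIV. G k l * x $ l) = (\<alpha> *\<^sub>R ?u + \<alpha>' *\<^sub>R ?v) $ k" for k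
        by (simp add: G_def inner_vec_def sum_distrib_left sum_distrib_right sum.distrib algebra_simps)
      then show ?thesis
        by (simp add: G0 vec_eq_iff)
    qed
    have "\<alpha> *\<^sub>R ((p \<bullet> x) *\<^sub>R p + (q \<bullet> x) *\<^sub>R q) = 0 \<and> \<alpha>' *\<^sub>R ((p' \<bullet> x) *\<^sub>R p' + (q' \<bullet> x) *\<^sub>R q') = 0" for x
    proof -
      let ?u = "(p \<bullet> x) *\<^sub>R p + (q \<bullet> x) *\<^sub>R q" and ?v = "(p' \<bullet> x) *\<^sub>R p' + (q' \<bullet> x) *\<^sub>R q'"
      have "N (N (\<alpha> *\<^sub>R ?u + \<alpha>' *\<^sub>R ?v)) = - \<beta>\<^sup>2 *\<^sub>R (\<alpha> *\<^sub>R ?u) - \<gamma>\<^sup>2 *\<^sub>R (\<alpha>' *\<^sub>R ?v)"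
        by (simp add: linear_add[OF linN] linear_cmul[OF linN] N2 algebra_simps)
      moreover have "N (N 0) = 0"
        by (simp add: linear_0[OF linN])
      ultimately have 1: "\<beta>\<^sup>2 *\<^sub>R (\<alpha> *\<^sub>R ?u) + \<gamma>\<^sup>2 *\<^sub>R (\<alpha>' *\<^sub>R ?v) = 0"
        unfolding comb[of x] by (simp add: algebra_simps)
      have eq: "\<alpha>' *\<^sub>R ?v = - (\<alpha> *\<^sub>R ?u)"
        using comb[of x] by (metis add.commute eq_neg_iff_add_eq_0)
      have "(\<beta>\<^sup>2 - \<gamma>\<^sup>2) *\<^sub>R (\<alpha> *\<^sub>R ?u) = 0"
        using 1 unfolding eq by (simp only: scaleR_minus_right scaleR_diff_left) simp
      then have "\<alpha> *\<^sub>R ?u = 0"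
        using neq by (simp only: scaleR_eq_0_iff) simp
      then show ?thesis
        using eq by simp
    qed
    note zero = this
    have nz: "\<kappa> = 0" if "x \<noteq> 0 \<or> y \<noteq> 0" "\<And>z. \<kappa> *\<^sub>R ((x \<bullet> z) *\<^sub>R x + (y \<bullet> z) *\<^sub>R y) = 0"
      for \<kappa> and x y :: "real^'n"
    proof (rule ccontr)
      assume "\<kappa> \<noteq> 0"
      then have "(x \<bullet> z) *\<^sub>R x + (y \<bullet> z) *\<^sub>R y = 0" for z
        using that(2)[of z] by (simp only: scaleR_eq_0_iff) simp
      then have "((x \<bullet> z) *\<^sub>R x + (y \<bullet> z) *\<^sub>R y) \<bullet> z = 0" for z
        by simp
      then have "(x \<bullet> z)\<^sup>2 + (y \<bullet> z)\<^sup>2 = 0" for z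
        by (simp add: inner_add_left power2_eq_square)
      then have "x \<bullet> x = 0" "y \<bullet> y = 0"
        by (simp_all add: sum_power2_eq_zero_iff)
      with that(1) show False by simp
    qed
    show False
      using \<alpha>(1) nz[of p q \<alpha>] nz[of p' q' \<alpha>'] pq(3) pq'(3) zero by blast
  qed
  ultimately show ?thesis
    unfolding det_eq_0_iff_ker by blast
qed

text \<open>
  For a diagonal matrix the Krylov rows are the powers of the numbers \<open>b i + b j\<close>, so this is
  a Vandermonde determinant with pairwise distinct nodes. A vector \<open>c\<close> in the kernel is symmetric and
  annihilates all polynomials of degree below \<open>N\<close> in the nodes; the polynomial with zeros at all
  nodes but one then isolates each entry of \<open>c\<close>.
\<close>

lemma det_krylov_diag_nonzero:
  fixes b :: "'n::finite \<Rightarrow> real"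
  assumes "inj num"
    and e: "bij_betw e {p. num (fst p) \<le> num (snd p)} {..<N}"
    and b: "\<And>i j k l. b i + b j = b k + b l \<Longrightarrow> (i = k \<and> j = l) \<or> (i = l \<and> j = k)"
  shows "det (krylov_matrix num e (\<chi> i j. if i = j then b i else 0)) \<noteq> 0"
proof
  define U where "U = {p. num (fst p :: 'n) \<le> num (snd p)}"
  define B where "B = (\<chi> i j. if i = j then b i else 0)"
  define bs where "bs p = b (fst p) + b (snd p)" for p :: "'n \<times> 'n"
  have bs: "p = q \<or> p = prod.swap q" if "bs p = bs q" for p q
    using b[of "fst p" "snd p" "fst q" "snd q"] that by (auto simp: bs_def prod_eq_iff)
  have bs_swap: "bs (prod.swap p) = bs p" for p
    by (simp add: bs_def)
  have swapU: "prod.swap p \<in> U \<or> p \<in> U" for p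
    by (auto simp: U_def)
  have swapUU: "prod.swap p = p" if "p \<in> U" "prod.swap p \<in> U" for p
    using that \<open>inj num\<close> by (auto simp: U_def prod_eq_iff inj_def)
  have cardU: "card U = N"
    using bij_betw_same_card[OF e] by (simp add: U_def)
  assume "det (krylov_matrix num e B) = 0"
  then obtain c where "c \<noteq> 0" and ker: "krylov_matrix num e B *v c = 0"
    unfolding det_eq_0_iff_ker by blast
  have row: "(\<Sum>q\<in>UNIV. krylov_matrix num e B $ p $ q * c $ q) = 0" for p
  proof -
    have "(krylov_matrix num e B *v c) $ p = 0"
      by (simp add: ker)
    then show ?thesis
      by (simp add: matrix_vector_mult_def)
  qed
  have symU: "c $ prod.swap p = c $ p" if "p \<notin> U" for p
  proof -
    have "(\<Sum>q\<in>UNIV. (of_bool (q = p) - of_bool (q = prod.swap p)) * c $ q) = 0"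
      using row[of p] that by (simp add: krylov_matrix_def U_def)
    then show ?thesis
      by (simp add: left_diff_distrib sum_subtractf of_bool_def if_distribR
          if_distrib[of "\<lambda>x. x * _"] cong: if_cong)
  qed
  have sym: "c $ prod.swap p = c $ p" for p
    using symU[of p] symU[of "prod.swap p"] swapUU[of p] by (metis swap_swap)
  have moment: "(\<Sum>q\<in>UNIV. bs q ^ k * c $ q) = 0" if "k < N" for k
  proof -
    have "k \<in> e ` U"
      using bij_betw_imp_surj_on[OF e] that by (simp add: U_def)
    then obtain p where "p \<in> U" "e p = k"
      by auto
    then show ?thesis
      using row[of p] by (simp add: krylov_matrix_def U_def B_def lyap_pow_diag bs_def)
  qed
  have poly_moment: "(\<Sum>q\<in>UNIV. poly P (bs q) * c $ q) = 0" if "degree P < N" for P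
  proof -
    have "(\<Sum>q\<in>UNIV. poly P (bs q) * c $ q)
        = (\<Sum>q\<in>UNIV. \<Sum>i\<le>degree P. coeff P i * (bs q ^ i * c $ q))"
      by (simp add: poly_altdef sum_distrib_right mult.assoc)
    also have "\<dots> = (\<Sum>i\<le>degree P. coeff P i * (\<Sum>q\<in>UNIV. bs q ^ i * c $ q))"
      by (subst sum.swap) (simp add: sum_distrib_left)
    also have "\<dots> = 0"
      using that by (intro sum.neutral) (simp add: moment)
    finally show ?thesis .
  qed
  have "c $ q0 = 0" if "q0 \<in> U" for q0
  proof -
    define P where "P = (\<Prod>p\<in>U - {q0}. [:- bs p, 1:])"
    have "degree P \<le> (\<Sum>p\<in>U - {q0}. 1)"
      unfolding P_def by (rule order_trans[OF degree_prod_sum_le]) auto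
    also have "\<dots> < N"
      using that cardU card_gt_0_iff[of U] by auto
    finally have mom: "(\<Sum>q\<in>UNIV. poly P (bs q) * c $ q) = 0"
      by (rule poly_moment)
    have P0: "poly P (bs q) = 0" if "q \<notin> {q0, prod.swap q0}" for q
    proof -
      obtain p where "p \<in> U" "bs p = bs q" "p = q \<or> p = prod.swap q"
        using swapU[of q] bs_swap[of q] by blast
      moreover have "p \<noteq> q0"
        using calculation that by (metis insertI1 insertI2 swap_swap)
      ultimately show ?thesis
        unfolding P_def poly_prod by (intro prod_zero bexI[of _ p]) auto
    qed
    have P1: "poly P (bs q0) \<noteq> 0"
    proof -
      have "bs p \<noteq> bs q0" if "p \<in> U - {q0}" for p
        using that bs[of p q0] swapUU[of q0] \<open>q0 \<in> U\<close> by auto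
      then show ?thesis
        by (force simp: P_def poly_prod)
    qed
    have "(\<Sum>q\<in>UNIV. poly P (bs q) * c $ q) = (\<Sum>q\<in>{q0, prod.swap q0}. poly P (bs q) * c $ q)"
      by (rule sum.mono_neutral_right) (auto simp: P0)
    also have "\<dots> = (\<Sum>q\<in>{q0, prod.swap q0}. poly P (bs q0) * c $ q0)"
      by (intro sum.cong) (auto simp: bs_swap sym)
    finally show ?thesis
      using mom P1 by auto
  qed
  then have "c $ q = 0" for q
    using swapU[of q] sym[of q] by metis
  then show False
    using \<open>c \<noteq> 0\<close> by (simp add: vec_eq_iff)
qed

text \<open>
  Powers of two are a choice of diagonal entries whose pairwise sums, doubles included, are distinct.
\<close>

lemma two_power_sum_eq:
  assumes "(2::real) ^ i + 2 ^ j = 2 ^ k + 2 ^ l"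
  shows "(i = k \<and> j = l) \<or> (i = l \<and> j = k)"
proof -
  have le: "j \<le> l" if "i \<le> j" "k \<le> l" "(2::real) ^ i + 2 ^ j = 2 ^ k + 2 ^ l" for i j k l :: nat
  proof (rule ccontr)
    assume "\<not> j \<le> l"
    then have "(2::real) ^ Suc l \<le> 2 ^ j"
      by (intro power_increasing) auto
    moreover have "(2::real) ^ k \<le> 2 ^ l" "(0::real) < 2 ^ i"
      using that by (auto intro: power_increasing)
    ultimately show False
      using that(3) by simp
  qed
  have ordered: "i = k \<and> j = l" if "i \<le> j" "k \<le> l" "(2::real) ^ i + 2 ^ j = 2 ^ k + 2 ^ l"
    for i j k l :: nat
  proof -
    have "j = l"
      using le[of i j k l] le[of k l i j] that by simp
    then show ?thesis
      using that(3) power_inject_exp[of "2::real" i k] by simp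
  qed
  show ?thesis
    using assms ordered[of i j k l] ordered[of j i k l] ordered[of i j l k] ordered[of j i l k]
    by (metis add.commute linear)
qed

section \<open>Eigenvalues of a real matrix\<close>

text \<open>
  The complex eigenvector equation for \<open>p + \<i> q\<close> split into real and imaginary parts, which keeps the
  analysis of the exceptional sets inside real matrices.
\<close>

definition real_eigenpair :: "real^'n^'n \<Rightarrow> complex \<Rightarrow> real^'n \<Rightarrow> real^'n \<Rightarrow> bool" where
  "real_eigenpair M z p q \<longleftrightarrow> (p \<noteq> 0 \<or> q \<noteq> 0)
     \<and> M *v p = Re z *\<^sub>R p - Im z *\<^sub>R q \<and> M *v q = Im z *\<^sub>R p + Re z *\<^sub>R q"

definition eigenvalues :: "real^'n^'n \<Rightarrow> complex set" where
  "eigenvalues M = {z. \<exists>p q. real_eigenpair M z p q}"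

lemma real_eigenpair_iff:
  "real_eigenpair M z p q \<longleftrightarrow> (\<chi> i. Complex (p $ i) (q $ i)) \<noteq> 0 \<and>
     map_matrix complex_of_real M *v (\<chi> i. Complex (p $ i) (q $ i))
       = z *s (\<chi> i. Complex (p $ i) (q $ i))"
proof -
  have "(map_matrix complex_of_real M *v (\<chi> i. Complex (p $ i) (q $ i))) $ k
     = Complex ((M *v p) $ k) ((M *v q) $ k)" for k
    by (simp add: matrix_vector_mult_def complex_eq_iff)
  then show ?thesis
    by (auto simp: real_eigenpair_def vec_eq_iff complex_eq_iff algebra_simps)
qed

lemma spectrum_eq_eigenvalues: "spectrum A = eigenvalues (matrix A)"
proof -
  have "(\<exists>v::complex^'n. P v) \<longleftrightarrow> (\<exists>p q. P (\<chi> i. Complex (p $ i) (q $ i)))"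
    (is "?l \<longleftrightarrow> ?r") for P
  proof
    assume ?l
    then obtain v where "P v" ..
    moreover have "(\<chi> i. Complex ((\<chi> i. Re (v $ i)) $ i) ((\<chi> i. Im (v $ i)) $ i)) = v"
      by (simp add: vec_eq_iff)
    ultimately show ?r
      by metis
  qed auto
  then show ?thesis
    unfolding spectrum_def eigenvalues_def real_eigenpair_iff by (intro Collect_cong)
qed

text \<open>
  Eigenvalues are roots of the characteristic polynomial, which is nonzero because the determinant,
  a homogeneous function, does not vanish at the identity and so not on the whole line
  \<open>A + s\<cdot>1\<close>.
\<close>

lemma finite_eigenvalues: "finite (eigenvalues M)"
proof -
  define A where "A = map_matrix complex_of_real M"
  define P where "P = (\<chi> i j. [:A $ i $ j, if i = j then -1 else 0:])"
  have eval: "map_matrix (\<lambda>p. poly p z) P = A - (\<chi> i j. if i = j then z else 0)" for z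
    by (simp add: vec_eq_iff P_def)
  have detP: "poly (det P) z = 0" if "z \<in> eigenvalues M" for z
  proof -
    from that obtain v where v: "v \<noteq> 0" "A *v v = z *s v"
      by (auto simp: eigenvalues_def real_eigenpair_iff A_def)
    have "(\<Sum>j\<in>UNIV. (if i = j then z else 0) * v $ j) = z * v $ i" for i
      by (simp add: if_distrib[of "\<lambda>x. x * _"] cong: if_cong)
    then have "(A - (\<chi> i j. if i = j then z else 0)) *v v = 0"
      using v(2) by (simp add: vec_eq_iff matrix_vector_mult_def left_diff_distrib sum_subtractf)
    then show ?thesis
      using v(1) by (auto simp: poly_det eval det_eq_0_iff_ker)
  qed
  have "\<exists>s. det (A + s *\<^sub>R mat 1) \<noteq> 0"
  proof (rule homogeneous_nonzero_meets_line)
    show "continuous_on UNIV (det :: complex^'n^'n \<Rightarrow> complex)"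
      by (rule continuous_on_det) (intro continuous_intros)
    show "det (c *\<^sub>R X) \<noteq> 0" if "c \<noteq> 0" "det X \<noteq> 0" for c and X :: "complex^'n^'n"
    proof -
      have "c *\<^sub>R X = (\<chi> i. complex_of_real c *s (X $ i))"
        by (simp add: vec_eq_iff scaleR_conv_of_real[where 'a = complex])
      then show ?thesis
        using that by (simp add: det_rows_mul)
    qed
  qed simp
  then obtain s where "det (A + s *\<^sub>R mat 1) \<noteq> 0" ..
  moreover have "A + s *\<^sub>R mat 1 = map_matrix (\<lambda>p. poly p (- of_real s)) P"
    by (simp add: eval vec_eq_iff mat_def scaleR_conv_of_real[where 'a = complex])
  ultimately have "det P \<noteq> 0"
    by (metis poly_0 poly_det)
  then show ?thesis
    using detP by (auto intro: finite_subset[OF _ poly_roots_finite])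
qed

section \<open>The exceptional sets of matrices\<close>

definition shared_real_part :: "(real^'n^'n) set" where
  "shared_real_part = {M. \<exists>z\<in>eigenvalues M. \<exists>w\<in>eigenvalues M. Re z = Re w \<and> z \<noteq> w \<and> z \<noteq> cnj w}"

text \<open>
  The cover is the zero set of the Krylov determinant. On every line in the direction of the diagonal
  matrix with entries \<open>2 ^ num i\<close> this determinant is a nonzero polynomial in the parameter.
\<close>

lemma shared_real_part_cover:
  "\<exists>C :: (real^'n^'n) set. closed C \<and> negligible C \<and> shared_real_part \<subseteq> C"
proof -
  obtain num :: "'n \<Rightarrow> nat" where "inj num"
    using finite_imp_inj_to_nat_seg[of "UNIV :: 'n set"] by auto
  obtain e N where e: "bij_betw e {p. num (fst p) \<le> num (snd p)} {..<N :: nat}"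
    using ex_bij_betw_finite_nat[OF finite[of "{p. num (fst p) \<le> num (snd p)}"]]
    by (auto simp: atLeast0LessThan)
  define f where "f M = det (krylov_matrix num e M)" for M :: "real^'n^'n"
  define C where "C = {M. f M = 0}"
  define B :: "real^'n^'n" where "B = (\<chi> i j. if i = j then 2 ^ num i else 0)"
  have "f B \<noteq> 0"
    unfolding f_def B_def
    by (rule det_krylov_diag_nonzero[OF \<open>inj num\<close> e])
       (use two_power_sum_eq injD[OF \<open>inj num\<close>] in blast)
  have cont: "continuous_on UNIV f"
    unfolding f_def by (intro continuous_on_det_krylov continuous_intros)
  then have "closed C"
    unfolding C_def by (intro closed_Collect_eq continuous_on_const)
  moreover have "negligible C"
  proof (rule negligible_if_line_sections_countable[OF \<open>closed C\<close>])
    fix A :: "real^'n^'n"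
    obtain s0 where s0: "f (A + s0 *\<^sub>R B) \<noteq> 0"
      using homogeneous_nonzero_meets_line[OF cont _ \<open>f B \<noteq> 0\<close>] det_krylov_scale
      unfolding f_def by blast
    define P where "P = (\<chi> i j. [:A $ i $ j, B $ i $ j:])"
    have eval: "map_matrix (\<lambda>p. poly p s) P = A + s *\<^sub>R B" for s
      by (simp add: vec_eq_iff P_def)
    have f_poly: "f (A + s *\<^sub>R B) = poly (det (krylov_matrix num e P)) s" for s
      by (simp add: f_def poly_det krylov_poly eval)
    then have "det (krylov_matrix num e P) \<noteq> 0"
      using s0 by auto
    then have "finite {s. f (A + s *\<^sub>R B) = 0}"
      unfolding f_poly by (rule poly_roots_finite)
    then show "countable {s. A + s *\<^sub>R B \<in> C}"
      by (simp add: C_def countable_finite)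
  qed
  moreover have "shared_real_part \<subseteq> C"
  proof
    fix M :: "real^'n^'n" assume "M \<in> shared_real_part"
    then obtain z w p q p' q' where *: "real_eigenpair M z p q" "real_eigenpair M w p' q'"
      "Re z = Re w" "z \<noteq> w" "z \<noteq> cnj w"
      by (auto simp: shared_real_part_def eigenvalues_def)
    have "(Im z)\<^sup>2 \<noteq> (Im w)\<^sup>2"
      using * by (auto simp: power2_eq_iff complex_eq_iff)
    then show "M \<in> C"
      using * det_krylov_eq_0[of M p "Re z" "Im z" q p' "Im w" q']
      by (simp add: C_def f_def real_eigenpair_def)
  qed
  ultimately show ?thesis
    by blast
qed

text \<open>
  The bound \<open>k\<close> on the imaginary part makes the closedness below a matter of projecting along a compact
  set. The value \<open>q = 0\<close> gives the imaginary axis, and the eigenvalue \<open>0\<close> satisfies the equation for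
  every \<open>q\<close>.
\<close>

definition eigenvalue_on_line :: "real \<Rightarrow> real \<Rightarrow> (real^'n^'n) set" where
  "eigenvalue_on_line q k = {M. \<exists>z\<in>eigenvalues M. Re z = q * Im z \<and> \<bar>Im z\<bar> \<le> k}"

text \<open>
  Normalising the eigenvector confines the pair of imaginary part and eigenvector to the compact set
  \<open>?K\<close>, and the set is the projection of a closed relation along \<open>?K\<close>.
\<close>

lemma closed_eigenvalue_on_line: "closed (eigenvalue_on_line q k :: (real^'n^'n) set)"
proof -
  let ?K = "{-k..k} \<times> sphere (0 :: (real^'n) \<times> (real^'n)) 1"
  let ?T = "{y :: (real \<times> (real^'n) \<times> (real^'n)) \<times> (real^'n^'n).
      snd y *v fst (snd (fst y))
        = (q * fst (fst y)) *\<^sub>R fst (snd (fst y)) - fst (fst y) *\<^sub>R snd (snd (fst y)) \<and>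
      snd y *v snd (snd (fst y))
        = fst (fst y) *\<^sub>R fst (snd (fst y)) + (q * fst (fst y)) *\<^sub>R snd (snd (fst y))}"
  have cmult: "continuous_on S (\<lambda>y. F y *v g y)"
    if "continuous_on S F" "continuous_on S g"
    for S and F :: "'z::topological_space \<Rightarrow> real^'n^'n" and g
    unfolding matrix_vector_mult_def
    by (intro continuous_on_vec_lambda continuous_on_sum continuous_on_mult
        continuous_on_component that)
  have "closed ?T"
    by (intro closed_Collect_conj closed_Collect_eq cmult continuous_on_add continuous_on_diff
        continuous_on_scaleR continuous_on_mult continuous_on_fst continuous_on_snd
        continuous_on_const continuous_on_id)
  have "eigenvalue_on_line q k = {M. \<exists>x. x \<in> ?K \<and> (x, M) \<in> ?T}"
  proof (intro set_eqI iffI)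
    fix M :: "real^'n^'n" assume "M \<in> eigenvalue_on_line q k"
    then obtain z p r where z: "real_eigenpair M z p r" "Re z = q * Im z" "\<bar>Im z\<bar> \<le> k"
      by (auto simp: eigenvalue_on_line_def eigenvalues_def)
    define c where "c = inverse (norm (p, r))"
    have "(p, r) \<noteq> 0"
      using z(1) by (auto simp: real_eigenpair_def zero_prod_def)
    then have "norm (c *\<^sub>R (p, r)) = 1"
      by (simp add: c_def del: scaleR_Pair)
    then have "(Im z, c *\<^sub>R p, c *\<^sub>R r) \<in> ?K"
      using z(3) by auto
    moreover have "((Im z, c *\<^sub>R p, c *\<^sub>R r), M) \<in> ?T"
    proof -
      have "M *v p = (q * Im z) *\<^sub>R p - Im z *\<^sub>R r" "M *v r = Im z *\<^sub>R p + (q * Im z) *\<^sub>R r"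
        using z(1,2) by (simp_all add: real_eigenpair_def)
      then show ?thesis
        by (simp add: matrix_vector_mult_scaleR scaleR_diff_right scaleR_add_right mult_ac)
    qed
    ultimately show "M \<in> {M. \<exists>x. x \<in> ?K \<and> (x, M) \<in> ?T}"
      by blast
  next
    fix M assume "M \<in> {M. \<exists>x. x \<in> ?K \<and> (x, M) \<in> ?T}"
    then obtain \<beta> p r where "(\<beta>, p, r) \<in> ?K" "((\<beta>, p, r), M) \<in> ?T"
      by auto
    then have "real_eigenpair M (Complex (q * \<beta>) \<beta>) p r" "\<bar>\<beta>\<bar> \<le> k"
      by (auto simp: real_eigenpair_def)
    then show "M \<in> eigenvalue_on_line q k"
      by (auto simp: eigenvalue_on_line_def eigenvalues_def intro!: exI[of _ "Complex (q * \<beta>) \<beta>"])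
  qed
  then show ?thesis
    using closed_compact_projection[of ?K ?T] \<open>closed ?T\<close> by (simp add: compact_Times)
qed

lemma eigenvalues_shift:
  assumes "z \<in> eigenvalues (M + s *\<^sub>R mat 1)"
  shows "z - of_real s \<in> eigenvalues M"
proof -
  have "(M + s *\<^sub>R mat 1) *v x = M *v x + s *\<^sub>R x" for x
    by (simp add: matrix_vector_mult_add_rdistrib flip: scaleR_matrix_vector_assoc)
  then show ?thesis
    using assms by (auto simp: eigenvalues_def real_eigenpair_def algebra_simps)
qed

text \<open>
  Adding \<open>s\<close> times the identity moves every eigenvalue horizontally by \<open>s\<close>, and a horizontal line
  meets \<open>Re z = q Im z\<close> only once. So each of the finitely many eigenvalues of \<open>M\<close> excludes one \<open>s\<close>.
\<close>

lemma negligible_eigenvalue_on_line: "negligible (eigenvalue_on_line q k :: (real^'n^'n) set)"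
proof (rule negligible_if_line_sections_countable[OF closed_eigenvalue_on_line])
  fix M :: "real^'n^'n"
  have "s \<in> (\<lambda>z. q * Im z - Re z) ` eigenvalues M" if "M + s *\<^sub>R mat 1 \<in> eigenvalue_on_line q k" for s
  proof -
    from that obtain z where z: "z \<in> eigenvalues (M + s *\<^sub>R mat 1)" "Re z = q * Im z"
      by (auto simp: eigenvalue_on_line_def)
    then show ?thesis
      using eigenvalues_shift[OF z(1)] by (intro image_eqI[of _ _ "z - of_real s"]) auto
  qed
  then have "{s. M + s *\<^sub>R mat 1 \<in> eigenvalue_on_line q k} \<subseteq> (\<lambda>z. q * Im z - Re z) ` eigenvalues M"
    by auto
  then show "countable {s. M + s *\<^sub>R mat 1 \<in> eigenvalue_on_line q k}"
    using finite_eigenvalues by (meson countable_finite finite_imageI finite_subset)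
qed

section \<open>Nonresonance of generic spectra\<close>

lemma span_rat_subset_affine:
  assumes "Z \<subseteq> {complex_of_real (p + q * x) | p q. p \<in> \<rat> \<and> q \<in> \<rat>}" (is "_ \<subseteq> ?W")
  shows "span_rat Z \<subseteq> ?W"
proof -
  have mod: "module (\<lambda>(q::rat) (z::complex). of_rat q * z)"
    by unfold_locales (simp_all add: algebra_simps of_rat_add of_rat_mult)
  have sub: "module.subspace (\<lambda>(q::rat) (z::complex). of_rat q * z) ?W"
    unfolding module.subspace_def[OF mod]
  proof (intro conjI ballI allI)
    show "0 \<in> ?W"
      by (rule CollectI, rule exI[of _ 0], rule exI[of _ 0]) simp
    show "u + v \<in> ?W" if "u \<in> ?W" "v \<in> ?W" for u v
    proof -
      from that obtain p q p' q' where "u = complex_of_real (p + q * x)" "v = complex_of_real (p' + q' * x)"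
        "p \<in> \<rat>" "q \<in> \<rat>" "p' \<in> \<rat>" "q' \<in> \<rat>" by blast
      then show ?thesis
        by (intro CollectI exI[of _ "p + p'"] exI[of _ "q + q'"]) (simp add: algebra_simps)
    qed
    show "of_rat c * u \<in> ?W" if "u \<in> ?W" for c u
    proof -
      from that obtain p q where "u = complex_of_real (p + q * x)" "p \<in> \<rat>" "q \<in> \<rat>"
        by blast
      moreover have "of_rat c = complex_of_real (of_rat c)"
        by (cases c) (simp add: of_rat_rat)
      ultimately show ?thesis
        by (intro CollectI exI[of _ "of_rat c * p"] exI[of _ "of_rat c * q"]) (simp add: algebra_simps)
    qed
  qed
  show ?thesis
    unfolding span_rat_def by (rule module.span_minimal[OF mod assms sub])
qed

lemma Arg_exp_congruent: "\<exists>k::int. Arg (exp z) = Im z - of_int k * (2 * pi)"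
  using is_Arg_exp_diff_2pi[OF is_Arg_Arg[of "exp z"]] by (metis exp_not_eq_zero)

text \<open>
  The arguments of the two points are \<open>\<plusminus> t Im z\<close> modulo \<open>2 \<pi>\<close>. Hence, besides \<open>1\<close>, the set \<open>Delta Y\<close>
  contains only integers plus or minus \<open>x = t Im z / \<pi>\<close>, and its rational span lies in the span of \<open>1\<close>
  and \<open>x\<close>.
\<close>

lemma circle_nonresonant_exp_pair:
  assumes b: "b \<ge> 2" and "t > 0"
    and Y: "Y \<noteq> {}" "Y \<subseteq> {exp (of_real t * z), exp (of_real t * cnj z)}"
    and irrat: "Im z \<noteq> 0 \<Longrightarrow> t * Im z / pi \<notin> \<rat>"
    and indep: "\<And>p q. p \<in> \<rat> \<Longrightarrow> q \<in> \<rat> \<Longrightarrow> t * Re z / ln (real b) \<noteq> p + q * (t * Im z / pi)"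
  shows "circle_nonresonant b (exp (t * Re z)) Y"
proof -
  define x where "x = t * Im z / pi"
  have Delta: "\<delta> = 1 \<or> Im z \<noteq> 0 \<and> (\<exists>(m::int) s. s \<in> {1, -1} \<and> \<delta> = complex_of_real (of_int m + s * x))"
    if "\<delta> \<in> Delta Y" for \<delta>
  proof -
    from that obtain y y' where y: "y \<in> Y" "y' \<in> Y"
      and \<delta>: "\<delta> = 1 + complex_of_real ((Arg y - Arg y') / (2 * pi))"
      unfolding Delta_def by blast
    obtain u u' where u: "u = z \<or> u = cnj z" "u' = z \<or> u' = cnj z"
      and yu: "y = exp (of_real t * u)" "y' = exp (of_real t * u')"
      using y Y(2) by blast
    show ?thesis
    proof (cases "u = u'")
      case True
      then show ?thesis
        by (simp add: \<delta> yu)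
    next
      case False
      then have "Im z \<noteq> 0"
        using u by (auto simp: complex_eq_iff)
      obtain k k' :: int where k: "Arg y = t * Im u - of_int k * (2 * pi)"
          "Arg y' = t * Im u' - of_int k' * (2 * pi)"
        using Arg_exp_congruent[of "of_real t * u"] Arg_exp_congruent[of "of_real t * u'"]
        unfolding yu by auto
      obtain s :: real where s: "s \<in> {1, -1}" "Im u - Im u' = 2 * s * Im z"
      proof (cases "u = z")
        case True
        then show thesis
          using that[of 1] False u by auto
      next
        case False
        then show thesis
          using that[of "-1"] \<open>u \<noteq> u'\<close> u by auto
      qed
      have "1 + (Arg y - Arg y') / (2 * pi) = of_int (1 - k + k') + t * (Im u - Im u') / (2 * pi)"
        unfolding k by (simp add: field_simps)
      also have "\<dots> = of_int (1 - k + k') + s * x"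
        unfolding s(2) x_def by (simp add: field_simps)
      finally have "\<delta> = complex_of_real (of_int (1 - k + k') + s * x)"
        unfolding \<delta> by (metis of_real_1 of_real_add)
      with \<open>Im z \<noteq> 0\<close> s(1) show ?thesis
        by blast
    qed
  qed
  have "1 \<in> Delta Y"
    using Y(1) by (force simp: Delta_def)
  moreover have "\<delta> = 1" if "\<delta> \<in> Delta Y" "\<delta> \<in> \<rat>" for \<delta>
  proof (rule ccontr)
    assume "\<delta> \<noteq> 1"
    with Delta[OF that(1)] obtain m :: int and s where "Im z \<noteq> 0" "s \<in> {1, -1}"
      "\<delta> = complex_of_real (of_int m + s * x)" by blast
    moreover from this have "of_int m + s * x \<in> \<rat>"
      using that(2) by (simp only: Rats_complex_of_real_iff)
    then have "of_int m + s * x - of_int m \<in> \<rat>"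
      by (rule Rats_diff) simp
    then have "s * x \<in> \<rat>"
      by simp
    ultimately have "x \<in> \<rat>"
      by (auto simp: Rats_minus_iff)
    with irrat \<open>Im z \<noteq> 0\<close> show False
      by (simp add: x_def)
  qed
  ultimately have "Delta Y \<inter> \<rat> = {1}"
    by auto
  moreover have "complex_of_real (log (real b) (exp (t * Re z))) \<notin> span_rat (Delta Y)"
  proof -
    have "Delta Y \<subseteq> {complex_of_real (p + q * x) | p q. p \<in> \<rat> \<and> q \<in> \<rat>}"
    proof
      fix \<delta> assume "\<delta> \<in> Delta Y"
      from Delta[OF this] obtain p q where "\<delta> = complex_of_real (p + q * x)" "p \<in> \<rat>" "q \<in> \<rat>"
      proof (elim disjE conjE exE)
        assume "\<delta> = 1"
        with that[of 1 0] show thesis by simp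
      next
        fix m :: int and s assume "s \<in> {1, -1}" "\<delta> = complex_of_real (of_int m + s * x)"
        with that[of "of_int m" s] show thesis by auto
      qed
      then show "\<delta> \<in> {complex_of_real (p + q * x) | p q. p \<in> \<rat> \<and> q \<in> \<rat>}"
        by blast
    qed
    from span_rat_subset_affine[OF this]
    have span: "span_rat (Delta Y) \<subseteq> {complex_of_real (p + q * x) | p q. p \<in> \<rat> \<and> q \<in> \<rat>}" .
    show ?thesis
    proof
      assume "complex_of_real (log (real b) (exp (t * Re z))) \<in> span_rat (Delta Y)"
      with span obtain p q where "p \<in> \<rat>" "q \<in> \<rat>"
        "complex_of_real (log (real b) (exp (t * Re z))) = complex_of_real (p + q * x)"
        by blast
      with indep[of p q] show False
        by (simp only: of_real_eq_iff log_def ln_exp x_def)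
    qed
  qed
  ultimately show ?thesis
    unfolding circle_nonresonant_def by simp
qed

text \<open>
  By \<open>pair\<close>, the points of the exponentiated set on one circle come from one conjugate pair \<open>z\<close>,
  \<open>cnj z\<close>. Each violation of the hypotheses on \<open>t\<close> in \<open>circle_nonresonant_exp_pair\<close> is then a linear
  equation in \<open>t\<close> with rational parameters. The coefficient of \<open>t\<close> is not zero, for the second
  hypothesis by \<open>slope\<close>, so each equation has one solution, and only countably many \<open>t\<close> are bad.
\<close>

lemma exp_nonresonant_if_generic:
  assumes "finite Z" and b: "b \<ge> 2"
    and pair: "\<And>z w. z \<in> Z \<Longrightarrow> w \<in> Z \<Longrightarrow> Re z = Re w \<Longrightarrow> z = w \<or> z = cnj w"
    and slope: "\<And>z q. z \<in> Z \<Longrightarrow> q \<in> \<rat> \<Longrightarrow> Re z \<noteq> q * (ln (real b) / pi) * Im z"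
  shows "exp_nonresonant b Z"
proof -
  \<comment> \<open>The first family solves \<open>t Im z / \<pi> = p\<close>. When the imaginary part is zero it contributes
    only the value 0 of a division by zero, and the t chosen below is positive.\<close>
  define bad where "bad = (\<Union>z\<in>Z. (\<lambda>p. p * pi / Im z) ` \<rat>
     \<union> (\<lambda>(p, q). p / (Re z / ln (real b) - q * Im z / pi)) ` (\<rat> \<times> \<rat>))"
  have "countable bad"
    unfolding bad_def using \<open>finite Z\<close>
    by (intro countable_UN countable_Un countable_image countable_SIGMA countable_rat)
       (simp_all add: countable_finite countable_rat)
  then have "\<not> {0<..<1} \<subseteq> bad"
    using uncountable_open_interval[of 0 1] countable_subset by force
  then obtain t where t: "t > 0" "t \<notin> bad"
    by (meson greaterThanLessThan_iff subsetI)
  have lnb: "ln (real b) > 0"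
    using b by simp
  have irrat: "t * Im z / pi \<notin> \<rat>" if "z \<in> Z" "Im z \<noteq> 0" for z
  proof
    assume "t * Im z / pi \<in> \<rat>"
    then have "(t * Im z / pi) * pi / Im z \<in> bad"
      unfolding bad_def using that(1) by blast
    with t(2) that(2) show False
      by simp
  qed
  have indep: "t * Re z / ln (real b) \<noteq> p + q * (t * Im z / pi)"
    if "z \<in> Z" "p \<in> \<rat>" "q \<in> \<rat>" for z p q
  proof
    assume "t * Re z / ln (real b) = p + q * (t * Im z / pi)"
    then have "t * (Re z / ln (real b) - q * Im z / pi) = p"
      by (simp add: algebra_simps)
    moreover have "Re z / ln (real b) - q * Im z / pi \<noteq> 0"
      using slope[OF that(1,3)] lnb by (simp add: field_simps)
    ultimately have "t = p / (Re z / ln (real b) - q * Im z / pi)"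
      by (simp add: eq_divide_eq)
    then have "t \<in> bad"
      unfolding bad_def using that by force
    with t(2) show False ..
  qed
  have "nonresonant b ((\<lambda>z. exp (complex_of_real t * z)) ` Z)"
    unfolding nonresonant_def
  proof (intro allI impI)
    fix r :: real assume "r > 0"
    let ?Y = "(\<lambda>z. exp (complex_of_real t * z)) ` Z \<inter> sphere 0 r"
    have "circle_nonresonant b r ?Y" if "?Y \<noteq> {}"
    proof -
      from that obtain z where "z \<in> Z" "exp (of_real t * z) \<in> sphere 0 r"
        by blast
      then have z: "z \<in> Z" "r = exp (t * Re z)"
        by simp_all
      have "?Y \<subseteq> {exp (of_real t * z), exp (of_real t * cnj z)}"
      proof
        fix y assume "y \<in> ?Y"
        then obtain w where w: "w \<in> Z" "y = exp (of_real t * w)" "exp (t * Re w) = r"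
          by auto
        then have "Re w = Re z"
          using z(2) t(1) by simp
        then show "y \<in> {exp (of_real t * z), exp (of_real t * cnj z)}"
          using pair[OF w(1) z(1)] w(2) by auto
      qed
      then show ?thesis
        unfolding z(2) using that z
        by (intro circle_nonresonant_exp_pair b t(1) irrat indep) auto
    qed
    then show "?Y = {} \<or> circle_nonresonant b r ?Y"
      by blast
  qed
  then show ?thesis
    unfolding exp_nonresonant_def using t(1) by (auto intro!: exI[of _ t])
qed

theorem theorem4p1:
  fixes R :: "(real^'n \<Rightarrow> real^'n) set"
  defines "R \<equiv> (\<Union>b\<in>{2..}. resonant_maps b)"
  shows "meagre (matrix ` R) \<and> matrix ` R \<in> null_sets lebesgue"
proof -
  obtain C :: "(real^'n^'n) set" where C: "closed C" "negligible C" "shared_real_part \<subseteq> C"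
    using shared_real_part_cover by blast
  define \<C> where "\<C> = insert C
    (range (\<lambda>(\<rho>, b, k). eigenvalue_on_line (of_rat \<rho> * (ln (real b) / pi)) (real k)))"
  show ?thesis
  proof (rule meagre_null_if_countable_closed_negligible_cover)
    show "countable \<C>"
      by (simp add: \<C>_def)
    show "closed D" "negligible D" if "D \<in> \<C>" for D
      using that C closed_eigenvalue_on_line negligible_eigenvalue_on_line by (auto simp: \<C>_def)
    show "matrix ` R \<subseteq> \<Union>\<C>"
    proof
      fix M assume "M \<in> matrix ` R"
      then obtain b where b: "b \<ge> 2" "exp_resonant b (eigenvalues M)"
        by (auto simp: R_def resonant_maps_def spectrum_eq_eigenvalues)
      show "M \<in> \<Union>\<C>"
      proof (rule ccontr)
        assume "M \<notin> \<Union>\<C>"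
        then have gen: "M \<notin> shared_real_part"
            "\<And>\<rho> k. M \<notin> eigenvalue_on_line (of_rat \<rho> * (ln (real b) / pi)) (real k)"
          using C(3) by (auto simp: \<C>_def)
        have "exp_nonresonant b (eigenvalues M)"
        proof (rule exp_nonresonant_if_generic[OF finite_eigenvalues b(1)])
          show "z = w \<or> z = cnj w"
            if "z \<in> eigenvalues M" "w \<in> eigenvalues M" "Re z = Re w" for z w
            using gen(1) that by (auto simp: shared_real_part_def)
          show "Re z \<noteq> q * (ln (real b) / pi) * Im z" if "z \<in> eigenvalues M" "q \<in> \<rat>" for z q
          proof -
            obtain \<rho> where "q = of_rat \<rho>"
              using \<open>q \<in> \<rat>\<close> by (auto simp: Rats_def)
            moreover obtain k :: nat where "\<bar>Im z\<bar> \<le> real k"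
              using real_arch_simple by blast
            ultimately show ?thesis
              using gen(2)[of \<rho> k] that(1) by (auto simp: eigenvalue_on_line_def)
          qed
        qed
        with b(2) show False ..
      qed
    qed
  qed
qed

end
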